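(* For every $m, s \in \mathbb{Z}$, every odd integer $n$, and every even integer $k > 0$, there exists an integer $D \geq 2$, not a perfect square, such that $D \equiv m \pmod n$, the continued fraction expansion of $\sqrt{D}$ has period length $k$, and every universal quadratic form over $\mathbb{Z}[\sqrt{D}]$ has at least $s$ variables.
   Context: For a positive non-square integer $D$, the continued fraction expansion of $\sqrt{D}$ has the form $[a_0; \overline{a_1, \ldots, a_k}]$ with positive integers $a_i$, $a_k = 2a_0$; $k$ is the period length. For $\alpha = a + b\sqrt{D} \in \mathbb{Z}[\sqrt{D}]$, its conjugate is $\alpha' = a - b\sqrt{D}$; $\alpha$ is totally positive ($\alpha \succ 0$) if $\alpha > 0$ and $\alpha' > 0$. A quadratic form over $\mathbb{Z}[\sqrt{D}]$ in $r$ variables is $Q(x_1,\dots,x_r) = \sum_{1 \le i \le j \le r} \alpha_{ij} x_i x_j$ with $\alpha_{ij} \in \mathbb{Z}[\sqrt{D}]$, the variables ranging over $\mathbb{Z}[\sqrt{D}]$. It is totally positive if $Q(\gamma_1,\dots,\gamma_r) \succ 0$ for all $(\gamma_1,\dots,\gamma_r) \in \mathbb{Z}[\sqrt{D}]^r \setminus \{0\}$. It is universal if it is totally positive and every totally positive $\alpha \in \mathbb{Z}[\sqrt{D}]$ equals $Q(\gamma_1,\dots,\gamma_r)$ for some $\gamma_i \in \mathbb{Z}[\sqrt{D}]$. *)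

theory Defs
  imports Complex_Main "HOL-Computational_Algebra.Nth_Powers" "HOL-Number_Theory.Cong"
begin

definition Zsqrt :: "int \<Rightarrow> real set" where
  "Zsqrt D = {of_int a + of_int b * sqrt (of_int D) | a b :: int. True}"

text \<open>The conjugate is only meaningful when \<open>D \<ge> 0\<close> is not a square and the argument lies in
  \<open>Zsqrt D\<close>; \<open>conj_Zsqrt_eq\<close> below shows that it is then well defined.\<close>

definition conj_Zsqrt :: "int \<Rightarrow> real \<Rightarrow> real" where
  "conj_Zsqrt D x =
     (THE y. \<exists>a b :: int. x = of_int a + of_int b * sqrt (of_int D) \<and>
                          y = of_int a - of_int b * sqrt (of_int D))"

definition totally_positive :: "int \<Rightarrow> real \<Rightarrow> bool" where
  "totally_positive D x \<longleftrightarrow> x > 0 \<and> conj_Zsqrt D x > 0"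

text \<open>A quadratic form in \<open>r\<close> variables is given by its coefficients \<open>\<alpha> i j\<close>, and an \<open>r\<close>-tuple by a
  function on the naturals; only indices with \<open>1 \<le> i \<le> j \<le> r\<close>, respectively \<open>1 \<le> i \<le> r\<close>, matter.\<close>

definition quadratic_form :: "int \<Rightarrow> nat \<Rightarrow> (nat \<Rightarrow> nat \<Rightarrow> real) \<Rightarrow> bool" where
  "quadratic_form D r \<alpha> \<longleftrightarrow> (\<forall>i\<in>{1..r}. \<forall>j\<in>{i..r}. \<alpha> i j \<in> Zsqrt D)"

definition qf_eval :: "nat \<Rightarrow> (nat \<Rightarrow> nat \<Rightarrow> real) \<Rightarrow> (nat \<Rightarrow> real) \<Rightarrow> real" where
  "qf_eval r \<alpha> x = (\<Sum>i=1..r. \<Sum>j=i..r. \<alpha> i j * x i * x j)"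

definition totally_positive_form :: "int \<Rightarrow> nat \<Rightarrow> (nat \<Rightarrow> nat \<Rightarrow> real) \<Rightarrow> bool" where
  "totally_positive_form D r \<alpha> \<longleftrightarrow> quadratic_form D r \<alpha> \<and>
     (\<forall>x. (\<forall>i\<in>{1..r}. x i \<in> Zsqrt D) \<and> (\<exists>i\<in>{1..r}. x i \<noteq> 0) \<longrightarrow>
          totally_positive D (qf_eval r \<alpha> x))"

definition universal_form :: "int \<Rightarrow> nat \<Rightarrow> (nat \<Rightarrow> nat \<Rightarrow> real) \<Rightarrow> bool" where
  "universal_form D r \<alpha> \<longleftrightarrow> totally_positive_form D r \<alpha> \<and>
     (\<forall>a\<in>Zsqrt D. totally_positive D a \<longrightarrow>
        (\<exists>x. (\<forall>i\<in>{1..r}. x i \<in> Zsqrt D) \<and> qf_eval r \<alpha> x = a))"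

text \<open>Complete quotients and partial quotients of the simple continued fraction of an irrational
  number. (For rational \<open>x\<close> the expansion terminates, and the values past its end are junk.)\<close>

fun cf_complete :: "real \<Rightarrow> nat \<Rightarrow> real" where
  "cf_complete x 0 = x"
| "cf_complete x (Suc i) = 1 / frac (cf_complete x i)"

definition cf_coeff :: "real \<Rightarrow> nat \<Rightarrow> int" where
  "cf_coeff x i = \<lfloor>cf_complete x i\<rfloor>"

text \<open>The expansion of \<open>x\<close> is \<open>[a\<^sub>0; a\<^sub>1, \<dots>, a\<^sub>k, a\<^sub>1, \<dots>, a\<^sub>k, \<dots>]\<close>, with \<open>k\<close> least possible. For
  \<open>x = sqrt D\<close> with \<open>D\<close> not a square, \<open>a\<^sub>k = 2 * a\<^sub>0\<close> is automatic.\<close>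

definition cf_period_length :: "real \<Rightarrow> nat \<Rightarrow> bool" where
  "cf_period_length x k \<longleftrightarrow>
     is_arg_min id (\<lambda>p. p > 0 \<and> (\<forall>i\<ge>1. cf_coeff x (i + p) = cf_coeff x i)) k"

lemma sqrt_irrational:
  fixes D :: int
  assumes "D \<ge> 0" "\<not> is_square D"
  shows "sqrt (of_int D) \<notin> \<rat>"
proof
  assume "sqrt (of_int D) \<in> \<rat>"
  then obtain p q :: int where pq: "q > 0" "coprime p q" "sqrt (of_int D) = of_int p / of_int q"
    by (metis Rats_cases')
  have "of_int D = (of_int p / of_int q :: real)^2"
    using assms(1) by (simp flip: pq(3))
  hence "of_int (D * q^2) = (of_int (p^2) :: real)"
    using pq(1) by (simp add: field_simps)
  hence eq: "D * q^2 = p^2"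
    by linarith
  have "q dvd p^2"
    unfolding eq[symmetric] by (simp add: power2_eq_square)
  moreover have "coprime q (p^2)"
    using pq(2) by (simp add: coprime_commute)
  ultimately have "is_unit q"
    by (meson coprime_absorb_left)
  hence "D = p^2"
    using eq pq(1) by simp
  thus False
    using assms(2) by auto
qed

lemma conj_Zsqrt_eq:
  fixes D a b :: int
  assumes "D \<ge> 0" "\<not> is_square D"
  shows "conj_Zsqrt D (of_int a + of_int b * sqrt (of_int D)) = of_int a - of_int b * sqrt (of_int D)"
proof -
  have uniq: "a = c \<and> b = d"
    if eq: "of_int a + of_int b * sqrt (of_int D) = of_int c + of_int d * sqrt (of_int D)"
    for c d :: int
  proof -
    have "b = d"
    proof (rule ccontr)
      assume "b \<noteq> d"
      hence "sqrt (of_int D) = of_int (c - a) / of_int (b - d)"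
        using eq by (simp add: field_simps)
      hence "sqrt (of_int D) \<in> \<rat>"
        by simp
      thus False
        using sqrt_irrational[OF assms] by simp
    qed
    thus ?thesis
      using eq by simp
  qed
  show ?thesis
    unfolding conj_Zsqrt_def by (rule the_equality) (use uniq in blast)+
qed

end

theory Submission
  imports Defs
begin

text \<open>
  Write \<open>a\<^sub>0 = \<lfloor>sqrt D\<rfloor>\<close>. The additive functional \<open>x + y sqrt D \<mapsto> x - a\<^sub>0 y\<close> is at least \<open>1\<close> on totally
  positive elements and equals \<open>1\<close> on each \<open>1 + t (a\<^sub>0 + sqrt D)\<close>; these elements are totally positive
  for \<open>0 \<le> t \<le> T\<close> when \<open>T (sqrt D - a\<^sub>0) < 1\<close>. If two vectors \<open>v\<close>, \<open>w\<close> representing two of them are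
  congruent modulo \<open>2\<close>, then \<open>v - w = 2 u\<close>, \<open>v + w = 2 u'\<close> and the parallelogram law gives
  \<open>Q u + Q u' = (Q v + Q w) / 2\<close>, on which the functional takes the value \<open>1\<close>. So \<open>u = 0\<close> or \<open>u' = 0\<close>,
  that is, \<open>v = \<plusminus>w\<close>. Hence the representing vectors are pairwise incongruent modulo \<open>2\<close>, and
  \<open>T < 4^r\<close>.

  It remains to find \<open>D\<close> with \<open>sqrt D = [a\<^sub>0; a, \<dots>, a, 2 a\<^sub>0, \<dots>]\<close>, where \<open>a\<close> is a large multiple of
  \<open>2 n\<close> repeated \<open>k - 1\<close> times. With \<open>f\<close> the Fibonacci-type sequence of ratio \<open>a\<close>, this holds for
  \<open>2 a\<^sub>0 = f\<^sub>k u - f\<^bsub>k-1\<^esub> f\<^bsub>k-2\<^esub>\<close> and \<open>D = a\<^sub>0\<^sup>2 + u f\<^bsub>k-1\<^esub> - f\<^bsub>k-2\<^esub>\<^sup>2\<close>, with any large \<open>u\<close>; modulo \<open>n\<close>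
  this \<open>D\<close> is just \<open>u\<close>.
\<close>

section \<open>Arithmetic in Z[sqrt D]\<close>

lemma Zsqrt_I: "of_int a + of_int b * sqrt (of_int D) \<in> Zsqrt D"
  unfolding Zsqrt_def by blast

lemma Zsqrt_E:
  assumes "x \<in> Zsqrt D"
  obtains a b :: int where "x = of_int a + of_int b * sqrt (of_int D)"
  using assms unfolding Zsqrt_def by blast

lemma Zsqrt_0: "0 \<in> Zsqrt D"
  using Zsqrt_I[of 0 0 D] by simp

lemma Zsqrt_add:
  assumes "x \<in> Zsqrt D" "y \<in> Zsqrt D"
  shows "x + y \<in> Zsqrt D"
proof -
  obtain a b c d :: int where x: "x = of_int a + of_int b * sqrt (of_int D)"
    and y: "y = of_int c + of_int d * sqrt (of_int D)"
    using assms by (elim Zsqrt_E)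
  have "x + y = of_int (a + c) + of_int (b + d) * sqrt (of_int D)"
    unfolding x y by (simp add: algebra_simps)
  thus ?thesis
    by (simp only: Zsqrt_I)
qed

lemma Zsqrt_mult:
  assumes "D \<ge> 0" "x \<in> Zsqrt D" "y \<in> Zsqrt D"
  shows "x * y \<in> Zsqrt D"
proof -
  obtain a b c d :: int where x: "x = of_int a + of_int b * sqrt (of_int D)"
    and y: "y = of_int c + of_int d * sqrt (of_int D)"
    using assms by (elim Zsqrt_E)
  have "x * y = of_int (a * c) + of_int (b * d) * (sqrt (of_int D) * sqrt (of_int D)) +
      of_int (a * d + b * c) * sqrt (of_int D)"
    unfolding x y of_int_add of_int_mult by (simp only: ring_distribs ac_simps)
  also have "sqrt (of_int D) * sqrt (of_int D) = (of_int D :: real)"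
    using assms(1) by simp
  finally have "x * y = of_int (a * c + b * d * D) + of_int (a * d + b * c) * sqrt (of_int D)"
    by simp
  thus ?thesis
    by (simp only: Zsqrt_I)
qed

lemma Zsqrt_sum: "(\<And>i. i \<in> A \<Longrightarrow> f i \<in> Zsqrt D) \<Longrightarrow> sum f A \<in> Zsqrt D"
  by (induction A rule: infinite_finite_induct) (auto intro: Zsqrt_0 Zsqrt_add)

lemma Zsqrt_qf_eval:
  assumes "D \<ge> 0" "quadratic_form D r \<alpha>" "\<forall>i\<in>{1..r}. x i \<in> Zsqrt D"
  shows "qf_eval r \<alpha> x \<in> Zsqrt D"
  unfolding qf_eval_def
  using assms by (intro Zsqrt_sum Zsqrt_mult) (auto simp: quadratic_form_def)

lemma Zsqrt_coords_unique:
  fixes a b c d D :: int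
  assumes "D \<ge> 0" "\<not> is_square D"
    and "of_int a + of_int b * sqrt (of_int D) = of_int c + of_int d * sqrt (of_int D)"
  shows "a = c \<and> b = d"
proof -
  have "of_int a - of_int b * sqrt (of_int D) = of_int c - of_int d * sqrt (of_int D)"
    using conj_Zsqrt_eq[OF assms(1,2)] assms(3) by metis
  with assms(3) have "a = c" and "of_int b * sqrt (of_int D) = of_int d * sqrt (of_int D)"
    by linarith+
  moreover have "D \<noteq> 0"
    using assms(2) by auto
  ultimately show ?thesis
    by simp
qed

section \<open>Lower bound for the number of variables\<close>

text \<open>For \<open>y \<ge> 0\<close> the value is at least the conjugate
  \<open>x - y * d\<close>; for \<open>y < 0\<close> it is at least \<open>x\<close>, half the sum
  of the element and its conjugate. Both are positive, and a positive integer is at least 1.\<close>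

lemma totally_positive_functional_ge_1:
  fixes x y a\<^sub>0 D :: int
  assumes D: "D \<ge> 0" "\<not> is_square D" and a\<^sub>0: "a\<^sub>0 \<ge> 0" "of_int a\<^sub>0 \<le> sqrt (of_int D)"
    and pos: "totally_positive D (of_int x + of_int y * sqrt (of_int D))"
  shows "x - a\<^sub>0 * y \<ge> 1"
proof -
  define d where "d = sqrt (of_int D)"
  have p: "of_int x + of_int y * d > 0" "of_int x - of_int y * d > 0"
    using pos conj_Zsqrt_eq[OF D, of x y] by (auto simp: totally_positive_def d_def)
  have "of_int (x - a\<^sub>0 * y) > (0 :: real)"
  proof (cases "y \<ge> 0")
    case True
    hence "of_int y * of_int a\<^sub>0 \<le> of_int y * d"
      using a\<^sub>0 by (intro mult_left_mono) (auto simp: d_def)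
    thus ?thesis
      using p by (simp add: mult.commute)
  next
    case False
    have "of_int a\<^sub>0 * of_int y \<le> (0 :: real)"
      using False a\<^sub>0 by (simp add: mult_nonneg_nonpos)
    thus ?thesis
      using p by simp
  qed
  thus ?thesis
    by linarith
qed

lemma qf_eval_parallelogram:
  "qf_eval r \<alpha> (\<lambda>i. x i + y i) + qf_eval r \<alpha> (\<lambda>i. x i - y i) = 2 * (qf_eval r \<alpha> x + qf_eval r \<alpha> y)"
  unfolding qf_eval_def sum.distrib[symmetric] sum_distrib_left
  by (intro sum.cong refl) (simp add: algebra_simps)

lemma qf_eval_cong:
  "(\<And>i. i \<in> {1..r} \<Longrightarrow> x i = y i) \<Longrightarrow> qf_eval r \<alpha> x = qf_eval r \<alpha> y"
  unfolding qf_eval_def by (intro sum.cong refl) auto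

lemma qf_eval_minus: "qf_eval r \<alpha> (\<lambda>i. - x i) = qf_eval r \<alpha> x"
  unfolding qf_eval_def by simp

lemma universal_form_variables:
  fixes D a\<^sub>0 :: int and T r :: nat
  assumes D: "D \<ge> 0" "\<not> is_square D" and a\<^sub>0: "a\<^sub>0 \<ge> 0" "of_int a\<^sub>0 \<le> sqrt (of_int D)"
    and T: "of_nat T * (sqrt (of_int D) - of_int a\<^sub>0) < 1"
    and univ: "universal_form D r \<alpha>"
  shows "T < 4 ^ r"
proof -
  define d where "d = sqrt (of_int D)"
  define Q where "Q = qf_eval r \<alpha>"
  define \<beta> where "\<beta> t = of_int (1 + int t * a\<^sub>0) + of_int (int t) * d" for t
  have Q_pos: "\<exists>p q :: int. Q x = of_int p + of_int q * d \<and> p - a\<^sub>0 * q \<ge> 1"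
    if x: "\<forall>i\<in>{1..r}. x i \<in> Zsqrt D" "\<exists>i\<in>{1..r}. x i \<noteq> 0" for x
  proof -
    have form: "totally_positive_form D r \<alpha>"
      using univ by (simp add: universal_form_def)
    hence "Q x \<in> Zsqrt D"
      using Zsqrt_qf_eval D x by (auto simp: Q_def totally_positive_form_def)
    then obtain p q :: int where pq: "Q x = of_int p + of_int q * d"
      unfolding d_def by (elim Zsqrt_E)
    have "totally_positive D (Q x)"
      using form x by (simp add: Q_def totally_positive_form_def)
    thus ?thesis
      using totally_positive_functional_ge_1[OF D a\<^sub>0] pq unfolding d_def by metis
  qed
  have \<beta>_pos: "totally_positive D (\<beta> t)" if "t \<le> T" for t
  proof -
    have "d \<ge> 0"
      using D by (simp add: d_def)
    have "of_nat t * (d - of_int a\<^sub>0) \<le> of_nat T * (d - of_int a\<^sub>0)"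
      using that a\<^sub>0 by (intro mult_right_mono) (auto simp: d_def)
    also have "\<dots> < 1"
      using T by (simp add: d_def)
    finally have "of_int (1 + int t * a\<^sub>0) - of_int (int t) * d > 0"
      by (simp add: algebra_simps)
    moreover have "of_int (1 + int t * a\<^sub>0) + of_int (int t) * d > 0"
      using a\<^sub>0 \<open>d \<ge> 0\<close> by (simp add: add_pos_nonneg)
    ultimately show ?thesis
      unfolding totally_positive_def \<beta>_def d_def conj_Zsqrt_eq[OF D] by blast
  qed
  have "\<exists>A B :: nat \<Rightarrow> int. Q (\<lambda>i. of_int (A i) + of_int (B i) * d) = \<beta> t" if t: "t \<le> T" for t
  proof -
    have "\<beta> t \<in> Zsqrt D"
      unfolding \<beta>_def d_def by (rule Zsqrt_I)
    then obtain x where x: "\<forall>i\<in>{1..r}. x i \<in> Zsqrt D" "Q x = \<beta> t"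
      using univ \<beta>_pos[OF t] by (auto simp: universal_form_def Q_def)
    have "\<forall>i\<in>{1..r}. \<exists>a b :: int. x i = of_int a + of_int b * d"
      using x(1) unfolding d_def by (blast elim: Zsqrt_E)
    then obtain A B :: "nat \<Rightarrow> int" where "\<forall>i\<in>{1..r}. x i = of_int (A i) + of_int (B i) * d"
      by metis
    hence "Q (\<lambda>i. of_int (A i) + of_int (B i) * d) = Q x"
      unfolding Q_def by (intro qf_eval_cong) auto
    thus ?thesis
      using x(2) by auto
  qed
  then obtain A B :: "nat \<Rightarrow> nat \<Rightarrow> int"
    where AB: "\<And>t. t \<le> T \<Longrightarrow> Q (\<lambda>i. of_int (A t i) + of_int (B t i) * d) = \<beta> t"
    by metis
  \<comment> \<open>The class modulo 2 of the 2r integer coordinates; there are \<open>4 ^ r\<close>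
    such classes.\<close>
  define par where "par t = ({i\<in>{1..r}. odd (A t i)}, {i\<in>{1..r}. odd (B t i)})" for t
  have "inj_on par {..T}"
  proof (rule inj_onI, rule ccontr)
    fix s t assume st: "s \<in> {..T}" "t \<in> {..T}" "par s = par t" "s \<noteq> t"
    define v where "v t i = of_int (A t i) + of_int (B t i) * d" for t i
    define x where "x i = (v s i + v t i) / 2" for i
    define y where "y i = (v s i - v t i) / 2" for i
    have Qv: "Q (v s) = \<beta> s" "Q (v t) = \<beta> t"
      using AB st unfolding v_def by auto
    \<comment> \<open>This rules out both \<open>v s = v t\<close> and \<open>v s = - v t\<close> on
      \<open>{1..r}\<close>, so that \<open>x\<close> and \<open>y\<close> are nonzero
      vectors.\<close>
    have neq: "Q (v s) \<noteq> Q (v t)"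
      using Qv st(4) Zsqrt_coords_unique[OF D, of "1 + int s * a\<^sub>0" "int s" "1 + int t * a\<^sub>0" "int t"]
      by (auto simp: \<beta>_def d_def)
    have xy_in: "x i \<in> Zsqrt D \<and> y i \<in> Zsqrt D" if i: "i \<in> {1..r}" for i
    proof -
      have "even (A s i) \<longleftrightarrow> even (A t i)" "even (B s i) \<longleftrightarrow> even (B t i)"
        using st(3) i unfolding par_def by blast+
      hence "even (A s i - A t i)" "even (B s i - B t i)"
        by simp_all
      then obtain p q where "A s i - A t i = 2 * p" "B s i - B t i = 2 * q"
        by (elim evenE)
      hence p: "A s i = A t i + 2 * p" and q: "B s i = B t i + 2 * q"
        by linarith+
      have "x i = of_int (A t i + p) + of_int (B t i + q) * d" "y i = of_int p + of_int q * d"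
        by (simp_all add: x_def y_def v_def p q field_simps)
      thus ?thesis
        unfolding d_def by (simp only: Zsqrt_I simp_thms)
    qed
    have x_nz: "\<exists>i\<in>{1..r}. x i \<noteq> 0"
    proof (rule ccontr)
      assume "\<not> ?thesis"
      hence "Q (v s) = Q (\<lambda>i. - v t i)"
        unfolding Q_def by (intro qf_eval_cong) (auto simp: x_def eq_neg_iff_add_eq_0)
      thus False
        using neq by (simp add: Q_def qf_eval_minus)
    qed
    have y_nz: "\<exists>i\<in>{1..r}. y i \<noteq> 0"
    proof (rule ccontr)
      assume "\<not> ?thesis"
      hence "Q (v s) = Q (v t)"
        unfolding Q_def by (intro qf_eval_cong) (auto simp: y_def)
      thus False
        using neq by simp
    qed
    obtain p q p' q' :: int where pq: "Q x = of_int p + of_int q * d" "p - a\<^sub>0 * q \<ge> 1"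
      "Q y = of_int p' + of_int q' * d" "p' - a\<^sub>0 * q' \<ge> 1"
      using Q_pos[of x] Q_pos[of y] xy_in x_nz y_nz by blast
    have "2 * (Q x + Q y) = Q (\<lambda>i. x i + y i) + Q (\<lambda>i. x i - y i)"
      unfolding Q_def by (rule qf_eval_parallelogram[symmetric])
    also have "(\<lambda>i. x i + y i) = v s"
      by (auto simp: x_def y_def field_simps)
    also have "(\<lambda>i. x i - y i) = v t"
      by (auto simp: x_def y_def field_simps)
    finally have "of_int (2 * (p + p')) + of_int (2 * (q + q')) * d =
        of_int (2 + (int s + int t) * a\<^sub>0) + of_int (int s + int t) * d"
      unfolding Qv \<beta>_def pq by (simp add: algebra_simps)
    hence "2 * (p + p') = 2 + (int s + int t) * a\<^sub>0 \<and> 2 * (q + q') = int s + int t"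
      unfolding d_def by (rule Zsqrt_coords_unique[OF D])
    hence "2 * ((p - a\<^sub>0 * q) + (p' - a\<^sub>0 * q')) = 2"
      by algebra
    moreover have "1 + 1 \<le> (p - a\<^sub>0 * q) + (p' - a\<^sub>0 * q')"
      using pq by (intro add_mono)
    ultimately show False
      by simp
  qed
  moreover have "par ` {..T} \<subseteq> Pow {1..r} \<times> Pow {1..r}"
    by (auto simp: par_def)
  \<comment> \<open>\<open>{..T}\<close> has T + 1 elements, hence the strict bound on
    \<open>T\<close>.\<close>
  ultimately have "card {..T} \<le> card (Pow {1..r} \<times> Pow {1..r})"
    by (intro card_inj_on_le) auto
  also have "\<dots> = 4 ^ r"
    by (simp add: card_cartesian_product card_Pow flip: power_mult_distrib)
  finally show ?thesis
    by simp
qed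

section \<open>Continuants of a constant sequence\<close>

text \<open>For \<open>a \<ge> 1\<close>, \<open>gfib a (i + 2) / gfib a (i + 1)\<close> is the
  continued fraction \<open>[a; a, ..., a]\<close> with i + 1 entries.\<close>

fun gfib :: "int \<Rightarrow> nat \<Rightarrow> int" where
  "gfib a 0 = 0"
| "gfib a (Suc 0) = 1"
| "gfib a (Suc (Suc i)) = a * gfib a (Suc i) + gfib a i"

lemma gfib_nonneg: "a \<ge> 0 \<Longrightarrow> gfib a i \<ge> 0"
  by (induction a i rule: gfib.induct) auto

lemma gfib_ge: "a \<ge> 1 \<Longrightarrow> gfib a (Suc i) \<ge> 1 \<and> gfib a (Suc (Suc i)) \<ge> a"
proof (induction i)
  case (Suc i)
  hence "a * 1 \<le> a * gfib a (Suc (Suc i))"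
    by (intro mult_left_mono) auto
  moreover have "gfib a (Suc (Suc (Suc i))) = a * gfib a (Suc (Suc i)) + gfib a (Suc i)"
    by (rule gfib.simps(3))
  ultimately show ?case
    using Suc by linarith
qed simp

text \<open>Up to sign, this is the determinant of a power of the matrix ((a, 1), (1, 0)) of
  determinant -1, so each induction step flips the sign.\<close>

lemma gfib_cassini: "gfib a (Suc i) ^ 2 - gfib a (Suc (Suc i)) * gfib a i = (-1) ^ i"
proof (induction i)
  case (Suc i)
  have "gfib a (Suc (Suc i)) ^ 2 - gfib a (Suc (Suc (Suc i))) * gfib a (Suc i) =
      - (gfib a (Suc i) ^ 2 - gfib a (Suc (Suc i)) * gfib a i)"
    by (simp add: algebra_simps power2_eq_square)
  thus ?case
    using Suc by simp
qed simp

text \<open>Modulo \<open>a\<close> the recurrence repeats the value two places earlier, so the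
  initial values 0 and 1 alternate.\<close>

lemma gfib_cong_even: "[gfib a (2 * i) = 0] (mod a) \<and> [gfib a (Suc (2 * i)) = 1] (mod a)"
  by (induction i) (auto simp: cong_def mod_simps)

section \<open>Continued fractions with a constant block\<close>

text \<open>The number \<open>[a; a, ..., a, z]\<close> with \<open>j\<close> copies of
  \<open>a\<close> before the tail \<open>z\<close>.\<close>

fun prepend_cf :: "int \<Rightarrow> real \<Rightarrow> nat \<Rightarrow> real" where
  "prepend_cf a z 0 = z"
| "prepend_cf a z (Suc j) = of_int a + 1 / prepend_cf a z j"

lemma prepend_cf_gt_1:
  assumes "a \<ge> 1" "z > 1"
  shows "prepend_cf a z j > 1"
proof (induction j)
  case (Suc j)
  have "of_int a \<ge> (1 :: real)" "1 / prepend_cf a z j > 0"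
    using assms Suc by simp_all
  thus ?case
    unfolding prepend_cf.simps by linarith
qed (use assms in simp)

text \<open>The inner value exceeds 1, so its reciprocal is the fractional part: one step of the
  continued fraction algorithm strips one \<open>a\<close>.\<close>

lemma prepend_cf_floor_frac:
  assumes "a \<ge> 1" "z > 1"
  shows "\<lfloor>prepend_cf a z (Suc j)\<rfloor> = a" "1 / frac (prepend_cf a z (Suc j)) = prepend_cf a z j"
proof -
  have "prepend_cf a z j > 1"
    using prepend_cf_gt_1[OF assms] .
  thus "\<lfloor>prepend_cf a z (Suc j)\<rfloor> = a"
    by (simp add: floor_eq_iff)
  thus "1 / frac (prepend_cf a z (Suc j)) = prepend_cf a z j"
    by (simp add: frac_def)
qed

text \<open>The block acts on the tail \<open>z\<close> as a fractional linear map whose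
  coefficients are continuants; its denominator is cleared here.\<close>

lemma prepend_cf_gfib:
  assumes "a \<ge> 1" "z > 1"
  shows "prepend_cf a z (Suc j) * (of_int (gfib a (Suc j)) * z + of_int (gfib a j)) =
         of_int (gfib a (Suc (Suc j))) * z + of_int (gfib a (Suc j))"
proof (induction j)
  case 0
  show ?case
    using assms by (simp add: field_simps)
next
  case (Suc j)
  define y where "y = prepend_cf a z (Suc j)"
  have "y > 1"
    unfolding y_def by (rule prepend_cf_gt_1[OF assms])
  have IH: "y * (of_int (gfib a (Suc j)) * z + of_int (gfib a j)) =
      of_int (gfib a (Suc (Suc j))) * z + of_int (gfib a (Suc j))"
    unfolding y_def by (rule Suc.IH)
  have "prepend_cf a z (Suc (Suc j)) * (of_int (gfib a (Suc (Suc j))) * z + of_int (gfib a (Suc j)))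
      = (of_int a + 1 / y) * (of_int (gfib a (Suc (Suc j))) * z + of_int (gfib a (Suc j)))"
    by (simp only: y_def prepend_cf.simps)
  also have "\<dots> = of_int a * (of_int (gfib a (Suc (Suc j))) * z + of_int (gfib a (Suc j)))
      + (of_int (gfib a (Suc j)) * z + of_int (gfib a j))"
    unfolding IH[symmetric] using \<open>y > 1\<close> by (simp add: distrib_right del: gfib.simps)
  also have "\<dots> = of_int (gfib a (Suc (Suc (Suc j)))) * z + of_int (gfib a (Suc (Suc j)))"
    by (simp add: algebra_simps)
  finally show ?case .
qed

text \<open>The equation says that \<open>x = [a\<^sub>0; a, ..., a, a\<^sub>0 + x]\<close> with j +
  1 copies of \<open>a\<close>. The tail has floor \<open>2 * a\<^sub>0\<close> and the fractional
  part of \<open>x\<close>, so the expansion repeats after j + 2 steps.\<close>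

lemma cf_period_length_prepend_cf:
  fixes a a\<^sub>0 :: int and x :: real
  assumes a: "a \<ge> 1" and a\<^sub>0: "2 * a\<^sub>0 > a" and "x > 0"
    and x: "(x - of_int a\<^sub>0) * prepend_cf a (of_int a\<^sub>0 + x) (Suc j) = 1"
  shows "\<lfloor>x\<rfloor> = a\<^sub>0" "of_int a * (x - of_int a\<^sub>0) < 1" "cf_period_length x (Suc (Suc j))"
proof -
  define z where "z = of_int a\<^sub>0 + x"
  define k where "k = Suc (Suc j)"
  define c where "c = cf_complete x"
  define y where "y = prepend_cf a z"
  have xy: "(x - of_int a\<^sub>0) * y (Suc j) = 1"
    using x by (simp only: y_def z_def)
  have "a\<^sub>0 \<ge> 1"
    using a a\<^sub>0 by linarith
  hence z: "z > 1"
    using \<open>x > 0\<close> unfolding z_def by linarith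
  have y_gt: "y (Suc j) > of_int a" "y (Suc j) > 1"
    using prepend_cf_gt_1[OF a z, of j] prepend_cf_gt_1[OF a z, of "Suc j"] by (simp_all add: y_def)
  have diff: "x - of_int a\<^sub>0 = 1 / y (Suc j)"
    using xy y_gt by (simp add: field_simps)
  have "0 < 1 / y (Suc j)" "1 / y (Suc j) < 1"
    using y_gt by (auto simp: field_simps)
  thus floor_x: "\<lfloor>x\<rfloor> = a\<^sub>0"
    unfolding floor_eq_iff diff[symmetric] by linarith
  show "of_int a * (x - of_int a\<^sub>0) < 1"
    unfolding diff using y_gt by (simp add: field_simps)
  have floor_z: "\<lfloor>z\<rfloor> = 2 * a\<^sub>0" and frac_z: "frac z = frac x"
    using floor_x by (simp_all add: z_def frac_def)
  have c_Suc: "c (Suc i) = 1 / frac (c i)" for i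
    by (simp add: c_def)
  have c1: "c 1 = y (Suc j)"
    by (simp add: c_def frac_def floor_x diff)
  have c_y: "i \<le> Suc j \<Longrightarrow> c (Suc i) = y (Suc j - i)" for i
  proof (induction i)
    case (Suc i)
    have "Suc j - i = Suc (Suc j - Suc i)"
      using Suc by simp
    thus ?case
      using Suc c_Suc[of "Suc i"] prepend_cf_floor_frac(2)[OF a z] unfolding y_def by simp
  qed (use c1 in simp)
  have c_k: "c k = z"
    using c_y[of "Suc j"] by (simp add: k_def y_def)
  \<comment> \<open>Periodicity starts at index 1: \<open>c k = a\<^sub>0 + x\<close> differs from
    \<open>c 0 = x\<close>, but their fractional parts agree.\<close>
  have periodic: "c (Suc i + k) = c (Suc i)" for i
  proof (induction i)
    case 0
    show ?case
      using c_Suc[of k] c_k frac_z by (simp add: c_def)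
  next
    case (Suc i)
    thus ?case
      using c_Suc[of "Suc i + k"] c_Suc[of "Suc i"] by simp
  qed
  have coeff_a: "cf_coeff x i = a" if "i > 0" "i < k" for i
  proof -
    have "c i = y (Suc (j - (i - 1)))"
      using c_y[of "i - 1"] that by (simp add: k_def Suc_diff_le)
    thus ?thesis
      using prepend_cf_floor_frac(1)[OF a z] by (simp add: cf_coeff_def c_def y_def)
  qed
  have coeff_k: "cf_coeff x k = 2 * a\<^sub>0"
    using c_k floor_z by (simp add: cf_coeff_def c_def)
  \<comment> \<open>A shorter period would carry the coefficient \<open>2 * a\<^sub>0\<close> at
    \<open>k\<close> back to \<open>k - p\<close>, where the coefficient is
    \<open>a < 2 * a\<^sub>0\<close>.\<close>
  have "\<not> p < k" if p: "p > 0" "\<forall>i\<ge>1. cf_coeff x (i + p) = cf_coeff x i" for p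
  proof
    assume "p < k"
    hence "cf_coeff x (k - p + p) = cf_coeff x (k - p)"
      using p(2) by (metis One_nat_def Suc_leI zero_less_diff)
    thus False
      using \<open>p < k\<close> p(1) coeff_a[of "k - p"] coeff_k a\<^sub>0 by simp
  qed
  moreover have "\<forall>i\<ge>1. cf_coeff x (i + k) = cf_coeff x i"
  proof (intro allI impI)
    fix i :: nat assume "i \<ge> 1"
    then obtain i' where "i = Suc i'"
      by (cases i) auto
    thus "cf_coeff x (i + k) = cf_coeff x i"
      using periodic by (simp add: cf_coeff_def c_def)
  qed
  ultimately have "cf_period_length x k"
    unfolding cf_period_length_def is_arg_min_def by (auto simp: k_def)
  thus "cf_period_length x (Suc (Suc j))"
    by (simp add: k_def)
qed

section \<open>Construction of \<open>D\<close>\<close>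

theorem theorem4p7:
  fixes m s n :: int and k :: nat
  assumes "odd n" and "even k" and "k > 0"
  shows "\<exists>D::int. D \<ge> 2 \<and> \<not> is_square D \<and> [D = m] (mod n) \<and>
           cf_period_length (sqrt (of_int D)) k \<and>
           (\<forall>r \<alpha>. universal_form D r \<alpha> \<longrightarrow> int r \<ge> s)"
proof -
  \<comment> \<open>The power of 4 will force \<open>s < r\<close>. The factor
    \<open>2 * \<bar>n\<bar>\<close> makes \<open>E\<close> and \<open>G\<close> below divisible by
    \<open>2 * n\<close>, so their halves \<open>e\<close> and \<open>g\<close> are integers
    divisible by \<open>n\<close>.\<close>
  define a where "a = 2 * \<bar>n\<bar> * 4 ^ nat s"
  have "k = Suc (Suc (k - 2)) \<and> even (k - 2)"
    using assms(2,3) by presburger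
  then obtain j where j: "k = Suc (Suc j)" "even j"
    by blast
  have "n \<noteq> 0"
    using assms(1) by auto
  hence n: "\<bar>n\<bar> \<ge> 1"
    by linarith
  have a: "a \<ge> 2" "2 * n dvd a"
    using mult_mono[of 2 "2 * \<bar>n\<bar>" 1 "4 ^ nat s"] n by (auto simp: a_def)
  define E where "E = gfib a (Suc (Suc j))"
  define F where "F = gfib a (Suc j)"
  define G where "G = gfib a j"
  have "[G = 0] (mod a)" "[F = 1] (mod a)"
    using gfib_cong_even[of a "j div 2"] j by (simp_all add: F_def G_def)
  hence cong: "2 * n dvd G" "2 * n dvd F - 1"
    using a(2) by (auto simp: cong_iff_dvd_diff intro: dvd_trans)
  have E_rec: "E = a * F + G"
    by (simp add: E_def F_def G_def)
  hence "2 * n dvd E"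
    using a(2) cong by simp
  then obtain e where e: "E = 2 * e" "n dvd e"
    by (metis dvdE dvd_triv_left mult.assoc)
  obtain g where g: "G = 2 * g" "n dvd g"
    using cong(1) by (metis dvdE dvd_triv_left mult.assoc)
  have ge: "E \<ge> a" "F \<ge> 1" "G \<ge> 0"
    using gfib_ge[of a j] gfib_nonneg[of a j] a by (auto simp: E_def F_def G_def)
  \<comment> \<open>The sign is +1 because \<open>j\<close> is even, and
    \<open>E * G = 4 * e * g\<close>.\<close>
  have cassini: "F\<^sup>2 - 4 * e * g = 1"
    using gfib_cassini[of a j] j(2) e(1) g(1) by (simp add: E_def F_def G_def)
  \<comment> \<open>\<open>N\<close> makes \<open>u\<close> large within the class of
    \<open>m\<close> modulo \<open>n\<close>: the terms \<open>F * g + a\<close> give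
    \<open>a\<^sub>0 \<ge> a\<close>, and \<open>G\<^sup>2\<close> gives
    \<open>D \<ge> a\<^sub>0\<^sup>2\<close>.\<close>
  define N where "N = \<bar>m\<bar> + F * g + a + G\<^sup>2"
  define u where "u = m + \<bar>n\<bar> * N"
  have "N \<ge> 0" "F * g \<ge> 0"
    using ge g a by (auto simp: N_def)
  hence "1 * N \<le> \<bar>n\<bar> * N"
    using n by (intro mult_right_mono)
  hence u: "u \<ge> F * g + a + G\<^sup>2"
    by (simp add: u_def N_def)
  define a\<^sub>0 where "a\<^sub>0 = e * u - F * g"
  define D where "D = a\<^sub>0\<^sup>2 + u * F - G\<^sup>2"
  have "u \<ge> 0"
    using u \<open>F * g \<ge> 0\<close> a by (smt (verit) zero_le_power2)
  hence "1 * u \<le> e * u" "u * 1 \<le> u * F"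
    using mult_right_mono[of 1 e u] mult_left_mono[of 1 F u] ge a e(1) by auto
  hence a\<^sub>0: "a\<^sub>0 \<ge> a" and D_ge: "D \<ge> a\<^sub>0\<^sup>2"
    using u \<open>F * g \<ge> 0\<close> a(1) zero_le_power2[of G] unfolding a\<^sub>0_def D_def by linarith+
  have "D \<ge> 2"
    using D_ge a\<^sub>0 a(1) power_mono[of 2 a\<^sub>0 2] by simp
  \<comment> \<open>This is the continued fraction equation for \<open>sqrt D\<close> with
    denominators cleared. Divisibility of the right side by \<open>E\<close> holds because
    \<open>2 * a\<^sub>0\<close> is congruent to \<open>- F * G\<close> modulo \<open>E\<close> and
    \<open>F\<^sup>2 - 1 = E * G\<close>.\<close>
  have eq: "E * (D - a\<^sub>0\<^sup>2) = 2 * a\<^sub>0 * F + G"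
  proof -
    have "2 * a\<^sub>0 * F + G = E * u * F - 2 * g * (F\<^sup>2 - 1)"
      by (simp add: a\<^sub>0_def e g algebra_simps power2_eq_square)
    also have "F\<^sup>2 - 1 = 4 * e * g"
      using cassini by simp
    finally show ?thesis
      by (simp add: D_def e g algebra_simps power2_eq_square)
  qed
  define x where "x = sqrt (of_int D)"
  define z where "z = of_int a\<^sub>0 + x"
  have x: "x > 0" "x * x = of_int D"
    using \<open>D \<ge> 2\<close> by (auto simp: x_def)
  have z: "z > 1"
    using x a\<^sub>0 a(1) by (simp add: z_def add.commute add_strict_increasing)
  have "a \<ge> 1"
    using a(1) by linarith
  have cf: "(x - of_int a\<^sub>0) * prepend_cf a (of_int a\<^sub>0 + x) (Suc j) = 1"
  proof -
    have pos: "of_int F * z + of_int G > 0"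
      using z ge by (intro add_pos_nonneg mult_pos_pos) auto
    have "of_int E * (of_int D - of_int a\<^sub>0 * of_int a\<^sub>0) = 2 * of_int a\<^sub>0 * of_int F + (of_int G :: real)"
      using arg_cong[OF eq, of "of_int :: int \<Rightarrow> real"] by (simp add: power2_eq_square)
    hence "(x - of_int a\<^sub>0) * (of_int E * z + of_int F) = of_int F * z + of_int G"
      using x(2) unfolding z_def by algebra
    hence "(x - of_int a\<^sub>0) * prepend_cf a z (Suc j) * (of_int F * z + of_int G) =
        1 * (of_int F * z + of_int G)"
      using prepend_cf_gfib[OF \<open>a \<ge> 1\<close> z, of j]
      by (simp only: E_def F_def G_def mult.assoc mult_1_left)
    thus ?thesis
      using pos unfolding z_def by simp
  qed
  have "2 * a\<^sub>0 > a"
    using a a\<^sub>0 by linarith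
  note period = cf_period_length_prepend_cf[OF \<open>a \<ge> 1\<close> this x(1) cf]
  have nonsquare: "\<not> is_square D"
  proof
    assume "is_square D"
    then obtain b where "D = b\<^sup>2"
      by (auto elim: is_nth_powerE)
    hence "x = of_int \<bar>b\<bar>"
      by (simp add: x_def)
    \<comment> \<open>An integer equals its floor; this makes the left side of \<open>cf\<close>
      zero.\<close>
    hence "x = of_int a\<^sub>0"
      using period(1) by (metis floor_of_int)
    thus False
      using cf by simp
  qed
  have D_cong: "[D = m] (mod n)"
  proof -
    have "n dvd a\<^sub>0" "n dvd F - 1" "n dvd u - m" "n dvd G"
      using e g cong by (auto simp: a\<^sub>0_def u_def)
    moreover have "D - m = a\<^sub>0 * a\<^sub>0 + (u * (F - 1) + (u - m)) - G * G"
      by (simp add: D_def power2_eq_square algebra_simps)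
    ultimately show ?thesis
      unfolding cong_iff_dvd_diff by (metis dvd_add dvd_diff dvd_mult)
  qed
  have "int r \<ge> s" if univ: "universal_form D r \<alpha>" for r \<alpha>
  proof -
    \<comment> \<open>\<open>T = a\<close> is admissible: the fractional part of
      \<open>sqrt D\<close> is the reciprocal of a complete quotient larger than
      \<open>a\<close>.\<close>
    have "of_nat (nat a) * (sqrt (of_int D) - of_int a\<^sub>0) < 1" "of_int a\<^sub>0 \<le> sqrt (of_int D)"
      using period(1,2) a(1) by (auto simp: x_def)
    hence "nat a < 4 ^ r"
      using \<open>D \<ge> 2\<close> a\<^sub>0 a(1) nonsquare univ by (intro universal_form_variables[of D a\<^sub>0]) auto
    hence "a < 4 ^ r"
      using a(1) by (simp add: nat_less_iff)
    moreover have "1 * 4 ^ nat s \<le> a"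
      unfolding a_def using n by (intro mult_right_mono) auto
    ultimately have "(4 :: int) ^ nat s < 4 ^ r"
      by linarith
    hence "nat s < r"
      by simp
    thus ?thesis
      by linarith
  qed
  thus ?thesis
    using \<open>D \<ge> 2\<close> nonsquare D_cong period(3) j(1) unfolding x_def by blast
qed

end
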